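(* Let $n\ge1$ be an integer. The cone $Q_+(n)$ is invariant with respect to transposition if and only if $n\le2$.
   Context: $Q_+(n)$ is the cone of positive semidefinite quaternionic hermitian $n\times n$ matrices, i.e. matrices $A\in\mathbb{H}^{n\times n}$ with $A=A^*$ ($*$ denoting the quaternionic conjugate transpose) and $v^*Av\ge0$ for all $v\in\mathbb{H}^n$. Transposition is the map $A\mapsto A^T$ without conjugation; for hermitian $A$ it equals entrywise quaternionic conjugation. *)

theory Defs
  imports
    Complex_Main
    "HOL-Library.Nonpos_Ints"
    "Jordan_Normal_Form.Matrix"
begin

section \<open>Quaternions\<close>

text \<open>\<open>Quat a b c d\<close> is the quaternion \<open>a + b i + c j + d k\<close>.\<close>

datatype quat = Quat (Re0: real) (Im1: real) (Im2: real) (Im3: real)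

lemma quat_eq_iff:
  "x = y \<longleftrightarrow> Re0 x = Re0 y \<and> Im1 x = Im1 y \<and> Im2 x = Im2 y \<and> Im3 x = Im3 y"
  by (cases x; cases y) simp

instantiation quat :: real_algebra_1
begin

definition zero_quat :: quat where "0 = Quat 0 0 0 0"

definition one_quat :: quat where "1 = Quat 1 0 0 0"

definition plus_quat :: "quat \<Rightarrow> quat \<Rightarrow> quat" where
  "x + y = Quat (Re0 x + Re0 y) (Im1 x + Im1 y) (Im2 x + Im2 y) (Im3 x + Im3 y)"

definition uminus_quat :: "quat \<Rightarrow> quat" where
  "- x = Quat (- Re0 x) (- Im1 x) (- Im2 x) (- Im3 x)"

definition minus_quat :: "quat \<Rightarrow> quat \<Rightarrow> quat" where
  "x - y = Quat (Re0 x - Re0 y) (Im1 x - Im1 y) (Im2 x - Im2 y) (Im3 x - Im3 y)"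

definition times_quat :: "quat \<Rightarrow> quat \<Rightarrow> quat" where
  "x * y = Quat
     (Re0 x * Re0 y - Im1 x * Im1 y - Im2 x * Im2 y - Im3 x * Im3 y)
     (Re0 x * Im1 y + Im1 x * Re0 y + Im2 x * Im3 y - Im3 x * Im2 y)
     (Re0 x * Im2 y - Im1 x * Im3 y + Im2 x * Re0 y + Im3 x * Im1 y)
     (Re0 x * Im3 y + Im1 x * Im2 y - Im2 x * Im1 y + Im3 x * Re0 y)"

definition scaleR_quat :: "real \<Rightarrow> quat \<Rightarrow> quat" where
  "scaleR r x = Quat (r * Re0 x) (r * Im1 x) (r * Im2 x) (r * Im3 x)"

instance
  by standard
    (simp_all add: quat_eq_iff zero_quat_def one_quat_def plus_quat_def uminus_quat_def
      minus_quat_def times_quat_def scaleR_quat_def algebra_simps)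

end

lemma quat_units:
  "Quat 0 1 0 0 * Quat 0 1 0 0 = - 1"
  "Quat 0 0 1 0 * Quat 0 0 1 0 = - 1"
  "Quat 0 0 0 1 * Quat 0 0 0 1 = - 1"
  "Quat 0 1 0 0 * Quat 0 0 1 0 = Quat 0 0 0 1"
  "Quat 0 0 1 0 * Quat 0 1 0 0 = - Quat 0 0 0 1"
  by (simp_all add: times_quat_def one_quat_def uminus_quat_def)

lemma of_real_quat: "of_real r = Quat r 0 0 0"
  by (simp add: of_real_def scaleR_quat_def one_quat_def)

definition qcnj :: "quat \<Rightarrow> quat" where
  "qcnj x = Quat (Re0 x) (- Im1 x) (- Im2 x) (- Im3 x)"


section \<open>Positive semidefinite quaternionic hermitian matrices\<close>

definition qadjoint :: "quat mat \<Rightarrow> quat mat" where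
  "qadjoint A = transpose_mat (map_mat qcnj A)"

text \<open>
  The library's \<open>v \<bullet> w\<close> is the bilinear sum of the products \<open>v $ i * w $ i\<close>, in this order
  of the factors, so \<open>map_vec qcnj v \<bullet> (A *\<^sub>v v)\<close> is the quaternion \<open>v\<^sup>* A v\<close>.
  That it is nonnegative means that it lies in \<open>\<real>\<^sub>\<ge>\<^sub>0\<close>, the image of the nonnegative reals
  under \<open>of_real\<close>.
\<close>

definition Q_plus :: "nat \<Rightarrow> quat mat set" where
  "Q_plus n = {A \<in> carrier_mat n n. qadjoint A = A \<and>
     (\<forall>v \<in> carrier_vec n. map_vec qcnj v \<bullet> (A *\<^sub>v v) \<in> \<real>\<^sub>\<ge>\<^sub>0)}"

end

theory Submission
  imports Defs
begin

text \<open>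
  For \<open>n = 2\<close>, if \<open>A\<close> has the off-diagonal entry \<open>q\<close>, then \<open>v\<^sup>* A v\<close> depends on \<open>v = (x, y)\<close>
  only through \<open>|x|\<close>, \<open>|y|\<close> and the real part of \<open>q y x\<^sup>*\<close>. Transposition replaces the latter by
  the real part of \<open>q x y\<^sup>*\<close>, and the substitution \<open>y \<mapsto> x y\<^sup>* x / |x|\<^sup>2\<close>, which preserves \<open>|y|\<close>,
  exchanges the two.

  For \<open>n \<ge> 3\<close> let \<open>w = (1, i, j, 0, \<dots>, 0)\<close>. The matrix \<open>A = w w\<^sup>*\<close> is positive semidefinite,
  but \<open>w\<^sup>* A\<^sup>T w = -3\<close>.
\<close>

lemmas quat_simps =
  quat_eq_iff zero_quat_def one_quat_def plus_quat_def uminus_quat_def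
  minus_quat_def times_quat_def scaleR_quat_def of_real_quat qcnj_def

definition qnorm2 :: "quat \<Rightarrow> real" where
  "qnorm2 x = (Re0 x)\<^sup>2 + (Im1 x)\<^sup>2 + (Im2 x)\<^sup>2 + (Im3 x)\<^sup>2"

lemma qnorm2_nonneg: "qnorm2 x \<ge> 0"
  by (simp add: qnorm2_def)

lemma qnorm2_eq_0_iff: "qnorm2 x = 0 \<longleftrightarrow> x = 0"
  by (auto simp: qnorm2_def quat_simps add_nonneg_eq_0_iff)

lemma qcnj_mult_self: "qcnj x * x = of_real (qnorm2 x)"
  by (simp add: qnorm2_def quat_simps power2_eq_square)

lemma mult_qcnj_self: "x * qcnj x = of_real (qnorm2 x)"
  by (simp add: qnorm2_def quat_simps power2_eq_square)

lemma qcnj_0 [simp]: "qcnj 0 = 0"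
  by (simp add: quat_simps)

lemma qcnj_qcnj [simp]: "qcnj (qcnj x) = x"
  by (simp add: quat_simps)

lemma qcnj_add: "qcnj (x + y) = qcnj x + qcnj y"
  by (simp add: quat_simps)

lemma qcnj_mult: "qcnj (x * y) = qcnj y * qcnj x"
  by (simp add: quat_simps algebra_simps)

lemma qcnj_sum: "qcnj (sum f S) = (\<Sum>i\<in>S. qcnj (f i))"
  by (induction S rule: infinite_finite_induct) (simp_all add: qcnj_add)

text \<open>Euler's four-square identity, verified by expanding coordinates.\<close>

lemma qnorm2_mult: "qnorm2 (x * y) = qnorm2 x * qnorm2 y"
  by (simp add: qnorm2_def times_quat_def power2_eq_square algebra_simps)

lemma qnorm2_qcnj [simp]: "qnorm2 (qcnj x) = qnorm2 x"
  by (simp add: qnorm2_def qcnj_def)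

lemma qnorm2_scaleR: "qnorm2 (r *\<^sub>R x) = r\<^sup>2 * qnorm2 x"
  by (simp add: qnorm2_def scaleR_quat_def power_mult_distrib algebra_simps)

lemma of_real_in_nonneg_Reals_quat_iff: "(of_real r :: quat) \<in> \<real>\<^sub>\<ge>\<^sub>0 \<longleftrightarrow> r \<ge> 0"
  by (auto simp: nonneg_Reals_def)

lemma qcnj_eq_self_imp_of_real: "qcnj x = x \<Longrightarrow> x = of_real (Re0 x)"
  by (simp add: quat_simps)

lemma swap_factor:
  obtains y' where "qnorm2 y' = qnorm2 y" "y' * qcnj x = x * qcnj y"
proof (cases "x = 0")
  \<comment> \<open>With \<open>x = 0\<close> both products vanish, so only the norm condition
    constrains \<open>y'\<close>.\<close>
  case True
  then show ?thesis using that[of y] by simp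
next
  case False
  then have nz: "qnorm2 x \<noteq> 0" by (simp add: qnorm2_eq_0_iff)
  let ?y = "(1 / qnorm2 x) *\<^sub>R (x * qcnj y * x)"
  have "qnorm2 ?y = qnorm2 y"
    using nz by (simp add: qnorm2_scaleR qnorm2_mult power2_eq_square)
  moreover have "?y * qcnj x = x * qcnj y"
    using nz by (simp add: mult.assoc mult_qcnj_self) (simp add: of_real_def)
  ultimately show ?thesis using that by blast
qed

lemma qadjoint_index:
  assumes "A \<in> carrier_mat n n" "i < n" "j < n"
  shows "qadjoint A $$ (i, j) = qcnj (A $$ (j, i))"
  using assms by (simp add: qadjoint_def)

text \<open>Entrywise conjugation commutes with transposition. Hence the transpose of a hermitian
  matrix is hermitian in every dimension, and only positivity is at stake.\<close>

lemma qadjoint_transpose: "qadjoint (transpose_mat A) = transpose_mat (qadjoint A)"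
  by (rule eq_matI) (simp_all add: qadjoint_def)

lemma form_eq_sum:
  assumes "A \<in> carrier_mat n n" "v \<in> carrier_vec n"
  shows "map_vec qcnj v \<bullet> (A *\<^sub>v v)
    = (\<Sum>i<n. \<Sum>j<n. qcnj (v $ i) * A $$ (i, j) * v $ j)"
  using assms
  by (simp add: scalar_prod_def sum_distrib_left mult.assoc atLeast0LessThan)

text \<open>Hermitian symmetry makes the diagonal entries real and the two cross terms conjugate to
  each other, so these add up to twice a real part. The real part is invariant under cyclic
  permutation of factors, which moves \<open>qcnj (v $ 0)\<close> next to
  \<open>v $ 1\<close>.\<close>

lemma form_2:
  assumes A: "A \<in> carrier_mat 2 2" and herm: "qadjoint A = A" and v: "v \<in> carrier_vec 2"
  shows "map_vec qcnj v \<bullet> (A *\<^sub>v v) =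
    of_real (Re0 (A $$ (0, 0)) * qnorm2 (v $ 0) + Re0 (A $$ (1, 1)) * qnorm2 (v $ 1)
      + 2 * Re0 (A $$ (0, 1) * (v $ 1 * qcnj (v $ 0))))"
proof -
  have cnj: "qcnj (A $$ (j, i)) = A $$ (i, j)" if "i < 2" "j < 2" for i j
    using qadjoint_index[OF A that] herm by simp
  define a where "a = Re0 (A $$ (0, 0))"
  define d where "d = Re0 (A $$ (1, 1))"
  define q x y where "q = A $$ (0, 1)" and "x = v $ 0" and "y = v $ 1"
  have a: "A $$ (0, 0) = of_real a" and d: "A $$ (1, 1) = of_real d"
    unfolding a_def d_def by (intro qcnj_eq_self_imp_of_real cnj; simp)+
  have q: "A $$ (1, 0) = qcnj q" by (simp add: cnj q_def)
  have "map_vec qcnj v \<bullet> (A *\<^sub>v v) =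
      qcnj x * of_real a * x + qcnj x * q * y + (qcnj y * qcnj q * x + qcnj y * of_real d * y)"
    unfolding form_eq_sum[OF A v]
    using a d q by (simp add: numeral_2_eq_2 q_def x_def y_def)
  also have "\<dots> = of_real (a * qnorm2 x + d * qnorm2 y + 2 * Re0 (q * (y * qcnj x)))"
    by (simp add: quat_simps qnorm2_def power2_eq_square algebra_simps)
  finally show ?thesis by (simp only: a_def d_def q_def x_def y_def)
qed

lemma transpose_in_Q_plus_1:
  assumes "A \<in> Q_plus 1"
  shows "transpose_mat A \<in> Q_plus 1"
proof -
  have "transpose_mat A = A"
    using assms by (intro eq_matI) (auto simp: Q_plus_def)
  then show ?thesis using assms by simp
qed

lemma transpose_in_Q_plus_2:
  assumes "A \<in> Q_plus 2"
  shows "transpose_mat A \<in> Q_plus 2"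
proof -
  have A: "A \<in> carrier_mat 2 2" and herm: "qadjoint A = A"
    and pos: "\<And>v. v \<in> carrier_vec 2 \<Longrightarrow> map_vec qcnj v \<bullet> (A *\<^sub>v v) \<in> \<real>\<^sub>\<ge>\<^sub>0"
    using assms by (auto simp: Q_plus_def)
  have At: "transpose_mat A \<in> carrier_mat 2 2" using A by simp
  have hermt: "qadjoint (transpose_mat A) = transpose_mat A"
    by (simp add: qadjoint_transpose herm)
  have "map_vec qcnj v \<bullet> (transpose_mat A *\<^sub>v v) \<in> \<real>\<^sub>\<ge>\<^sub>0" if v: "v \<in> carrier_vec 2" for v
  proof -
    define q x y where "q = A $$ (0, 1)" and "x = v $ 0" and "y = v $ 1"
    obtain y' where y': "qnorm2 y' = qnorm2 y" "y' * qcnj x = x * qcnj y"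
      by (rule swap_factor)
    define v' where "v' = vec 2 (\<lambda>i. if i = 0 then x else y')"
    have v': "v' \<in> carrier_vec 2" "v' $ 0 = x" "v' $ 1 = y'"
      by (simp_all add: v'_def)
    have q: "A $$ (1, 0) = qcnj q"
      using qadjoint_index[OF A, of 1 0] herm by (simp add: q_def)
    \<comment> \<open>Conjugating the left product gives \<open>x * qcnj y * q\<close>, and a cyclic
      permutation gives the right one; \<open>Re0\<close> respects both operations.\<close>
    have "Re0 (qcnj q * (y * qcnj x)) = Re0 (q * (x * qcnj y))"
      by (simp add: quat_simps algebra_simps)
    then have "map_vec qcnj v \<bullet> (transpose_mat A *\<^sub>v v) = map_vec qcnj v' \<bullet> (A *\<^sub>v v')"
      unfolding form_2[OF At hermt v] form_2[OF A herm v'(1)] v'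
      using A q y' by (simp add: q_def x_def y_def)
    then show ?thesis using pos[OF v'(1)] by simp
  qed
  then show ?thesis using At hermt by (simp add: Q_plus_def)
qed

text \<open>By associativity alone, the form of \<open>w w\<^sup>*\<close> at \<open>v\<close>
  factors as \<open>qcnj s * s\<close> with \<open>s = w\<^sup>* v\<close>, which is the squared
  norm of \<open>s\<close>.\<close>

lemma rank_one_in_Q_plus:
  "mat n n (\<lambda>(i, j). w i * qcnj (w j)) \<in> Q_plus n"
proof -
  define A where "A = mat n n (\<lambda>(i, j). w i * qcnj (w j))"
  have A: "A \<in> carrier_mat n n" by (simp add: A_def)
  have "qadjoint A = A"
    by (rule eq_matI) (simp_all add: A_def qadjoint_def qcnj_mult)
  moreover have "map_vec qcnj v \<bullet> (A *\<^sub>v v) \<in> \<real>\<^sub>\<ge>\<^sub>0" if v: "v \<in> carrier_vec n" for v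
  proof -
    define s where "s = (\<Sum>j<n. qcnj (w j) * v $ j)"
    have "map_vec qcnj v \<bullet> (A *\<^sub>v v)
        = (\<Sum>i<n. \<Sum>j<n. (qcnj (v $ i) * w i) * (qcnj (w j) * v $ j))"
      unfolding form_eq_sum[OF A v] by (simp add: A_def mult.assoc)
    also have "\<dots> = qcnj s * s"
      by (simp add: s_def qcnj_sum qcnj_mult sum_product)
    finally show ?thesis
      by (simp add: qcnj_mult_self of_real_in_nonneg_Reals_quat_iff qnorm2_nonneg)
  qed
  ultimately show ?thesis using A unfolding Q_plus_def A_def by blast
qed

lemma Q_plus_not_transpose_invariant:
  assumes "n \<ge> 3"
  shows "\<exists>A \<in> Q_plus n. transpose_mat A \<notin> Q_plus n"
proof
  define w where "w i = (if i = 0 then 1 else if i = 1 then Quat 0 1 0 0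
    else if i = 2 then Quat 0 0 1 0 else 0)" for i :: nat
  define A where "A = mat n n (\<lambda>(i, j). w i * qcnj (w j))"
  show "A \<in> Q_plus n"
    unfolding A_def by (rule rank_one_in_Q_plus)
  have At: "transpose_mat A \<in> carrier_mat n n" by (simp add: A_def)
  let ?t = "\<lambda>i j. qcnj (w i) * (w j * qcnj (w i)) * w j"
  \<comment> \<open>Since \<open>w\<close> vanishes from index 3 on, the double sum for arbitrary
    \<open>n\<close> shrinks to nine explicit terms.\<close>
  have restrict: "(\<Sum>i<n. f i) = (\<Sum>i<3. f i)" if "\<And>i. i \<ge> 3 \<Longrightarrow> f i = 0" for f :: "nat \<Rightarrow> quat"
    using assms that by (intro sum.mono_neutral_right) auto
  have w0: "w i = 0" if "i \<ge> 3" for i using that by (simp add: w_def)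
  have "map_vec qcnj (vec n w) \<bullet> (transpose_mat A *\<^sub>v vec n w) = (\<Sum>i<n. \<Sum>j<n. ?t i j)"
    unfolding form_eq_sum[OF At vec_carrier] by (simp add: A_def)
  also have "\<dots> = (\<Sum>i<3. \<Sum>j<3. ?t i j)"
    by (simp add: restrict w0)
  \<comment> \<open>The three diagonal terms are 1. Each of the six others is the square of one of
    the imaginary units up to sign, for example \<open>(-i) j (-i) j = k\<^sup>2\<close>, hence
    -1.\<close>
  also have "\<dots> = of_real (- 3)"
    by (simp add: numeral_3_eq_3 w_def quat_simps)
  finally have "map_vec qcnj (vec n w) \<bullet> (transpose_mat A *\<^sub>v vec n w) \<notin> \<real>\<^sub>\<ge>\<^sub>0"
    using of_real_in_nonneg_Reals_quat_iff[of "- 3"] by simp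
  then show "transpose_mat A \<notin> Q_plus n"
    unfolding Q_plus_def using vec_carrier by blast
qed

theorem corollaryA9:
  fixes n :: nat
  assumes "n \<ge> 1"
  shows "(\<forall>A \<in> Q_plus n. transpose_mat A \<in> Q_plus n) \<longleftrightarrow> n \<le> 2"
proof
  assume "\<forall>A \<in> Q_plus n. transpose_mat A \<in> Q_plus n"
  then show "n \<le> 2" using Q_plus_not_transpose_invariant[of n] by force
next
  assume "n \<le> 2"
  with assms have "n = 1 \<or> n = 2" by auto
  then show "\<forall>A \<in> Q_plus n. transpose_mat A \<in> Q_plus n"
    using transpose_in_Q_plus_1 transpose_in_Q_plus_2 by blast
qed

end
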